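(* Let $\mathbf{A}=\langle A,\vee,1\rangle$ be a distributive nearlattice. Then the following are equivalent: (1) $\mathbf{A}$ is quasicomplemented; (2) for each $a\in A$ there exists $b\in A$ such that $a^{\top}\cap b^{\top}=\{1\}$ and $a\vee b=1$.
   Context: A distributive nearlattice is a join-semilattice $\langle A,\vee,1\rangle$ with greatest element $1$ in which every principal filter $[a)=\{x\in A\colon a\le x\}$ is a bounded distributive lattice. For $a\in A$, $a^{\top}=\{x\in A\colon x\vee a=1\}$ and $a^{\top\top}=\{y\in A\colon y\vee x=1\text{ for all }x\in a^{\top}\}$. $\mathbf{A}$ is quasicomplemented if for each $a\in A$ there exists $b\in A$ with $a^{\top\top}=b^{\top}$. *)

theory Defs
  imports Main
begin

unbundle lattice_syntax

text \<open>
  Here \<open>S\<close> carries the order induced from the ambient type; meets and joins are the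
  binary infima and suprema computed inside \<open>S\<close>.
\<close>

definition (in order) bounded_distrib_lattice_on :: "'a set \<Rightarrow> bool" where
  "bounded_distrib_lattice_on S \<longleftrightarrow>
     (\<exists>l\<in>S. \<forall>x\<in>S. l \<le> x) \<and>
     (\<exists>u\<in>S. \<forall>x\<in>S. x \<le> u) \<and>
     (\<exists>meet join.
        (\<forall>x\<in>S. \<forall>y\<in>S. meet x y \<in> S \<and> meet x y \<le> x \<and> meet x y \<le> y \<and>
           (\<forall>z\<in>S. z \<le> x \<and> z \<le> y \<longrightarrow> z \<le> meet x y)) \<and>
        (\<forall>x\<in>S. \<forall>y\<in>S. join x y \<in> S \<and> x \<le> join x y \<and> y \<le> join x y \<and>
           (\<forall>z\<in>S. x \<le> z \<and> y \<le> z \<longrightarrow> join x y \<le> z)) \<and>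
        (\<forall>x\<in>S. \<forall>y\<in>S. \<forall>z\<in>S. meet x (join y z) = join (meet x y) (meet x z)))"

class distributive_nearlattice = semilattice_sup + order_top +
  assumes principal_filter_bounded_distrib_lattice: "bounded_distrib_lattice_on {a..}"

context distributive_nearlattice
begin

definition annihilator :: "'a \<Rightarrow> 'a set" where
  "annihilator a = {x. sup x a = top}"

definition double_annihilator :: "'a \<Rightarrow> 'a set" where
  "double_annihilator a = {y. \<forall>x\<in>annihilator a. sup y x = top}"

end

text \<open>
  A property of the whole structure: the phantom argument names the carrier type.
\<close>

definition quasicomplemented :: "'a::distributive_nearlattice itself \<Rightarrow> bool" where
  "quasicomplemented (_ :: 'a itself) \<longleftrightarrow>
     (\<forall>a::'a. \<exists>b::'a. double_annihilator a = annihilator b)"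

end

theory Submission
  imports Defs
begin

text \<open>The equivalence holds pair by pair, with the same witness b in both conditions
  (\<open>double_annihilator_eq_annihilator_iff\<close>). Since a lies in its own double
  annihilator, and an annihilator meets the double annihilator only in \<top>, equality forces both
  conditions on b. Conversely, a \<squnion> b = \<top> puts b in the annihilator of a, whence one
  inclusion; the other follows from the trivial intersection because annihilators are
  up-sets.\<close>

context distributive_nearlattice
begin

lemma annihilator_iff: "x \<in> annihilator a \<longleftrightarrow> x \<squnion> a = \<top>"
  by (simp add: annihilator_def)

lemma double_annihilator_iff:
  "y \<in> double_annihilator a \<longleftrightarrow> (\<forall>x. x \<squnion> a = \<top> \<longrightarrow> y \<squnion> x = \<top>)"
  by (simp add: double_annihilator_def annihilator_def Ball_def)

text \<open>Upward closure lets a join of elements from two annihilators lie in their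
  intersection.\<close>

lemma sup_eq_top_mono: "x \<squnion> a = \<top> \<Longrightarrow> x \<le> z \<Longrightarrow> z \<squnion> a = \<top>"
  by (metis sup_mono order_refl top_unique)

lemma double_annihilator_eq_annihilator_iff:
  "double_annihilator a = annihilator b \<longleftrightarrow>
     annihilator a \<inter> annihilator b = {\<top>} \<and> a \<squnion> b = \<top>"
proof
  assume eq: "double_annihilator a = annihilator b"
  have "a \<in> double_annihilator a"
    by (simp add: double_annihilator_iff sup_commute)
  then have "a \<squnion> b = \<top>"
    by (simp add: eq annihilator_iff)
  \<comment> \<open>By \<open>eq\<close>, x is also in the double annihilator of a; testing it
    against x itself gives x \<squnion> x = \<top>.\<close>
  moreover have "x = \<top>" if "x \<in> annihilator a" "x \<in> annihilator b" for x
    using that eq double_annihilator_iff[of x a] annihilator_iff[of x a] by auto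
  moreover have "\<top> \<in> annihilator a \<inter> annihilator b"
    by (simp add: annihilator_iff sup_absorb1)
  ultimately show "annihilator a \<inter> annihilator b = {\<top>} \<and> a \<squnion> b = \<top>"
    by blast
next
  assume asm: "annihilator a \<inter> annihilator b = {\<top>} \<and> a \<squnion> b = \<top>"
  show "double_annihilator a = annihilator b"
  proof (intro equalityI subsetI)
    fix y assume "y \<in> double_annihilator a"
    \<comment> \<open>The test element is b, which lies in the annihilator of a because a \<squnion>
      b = \<top>.\<close>
    then show "y \<in> annihilator b"
      using asm by (simp add: double_annihilator_iff annihilator_iff sup_commute)
  next
    fix y assume y: "y \<in> annihilator b"
    have "y \<squnion> x = \<top>" if "x \<squnion> a = \<top>" for x
    proof -
      \<comment> \<open>The join is above x, which annihilates a, and above y, which annihilates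
        b.\<close>
      have "y \<squnion> x \<in> annihilator a \<inter> annihilator b"
        using y that sup_eq_top_mono[of x a "y \<squnion> x"] sup_eq_top_mono[of y b "y \<squnion> x"]
        by (simp add: annihilator_iff)
      then show ?thesis using asm by blast
    qed
    then show "y \<in> double_annihilator a"
      by (simp add: double_annihilator_iff)
  qed
qed

end

theorem theorem3p4:
  shows "quasicomplemented TYPE('a::distributive_nearlattice) \<longleftrightarrow>
    (\<forall>a::'a. \<exists>b::'a. annihilator a \<inter> annihilator b = {\<top>} \<and> a \<squnion> b = \<top>)"
  by (simp add: quasicomplemented_def double_annihilator_eq_annihilator_iff)

end
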